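(* Let $t\in\mathbb{R}$ and $(a,b)\in\mathbb{H}_t$, realized as $[(a,b)]_t\in M_2(\mathbb{C})$. Then $$\mathrm{spec}\left([(a,b)]_t\right)=\left\{\mathrm{Re}(a)\pm\sqrt{\mathrm{Re}(a)^2-\det([(a,b)]_t)}\right\}\ \text{ in }\mathbb{C}.$$ More precisely, if $a=x+yi$ and $b=u+vi$ with $x,y,u,v\in\mathbb{R}$ and $i=\sqrt{-1}$, then $$\mathrm{spec}\left([(a,b)]_t\right)=\left\{x\pm i\sqrt{y^{2}-tu^{2}-tv^{2}}\right\}\ \text{ in }\mathbb{C}.$$
   Context: For $t\in\mathbb{R}$, $\mathbb{H}_t$ denotes the set $\mathbb{C}^2$ with usual addition and multiplication $(a_1,b_1)\cdot_t(a_2,b_2)=(a_1a_2+tb_1\overline{b_2},\;a_1b_2+b_1\overline{a_2})$. The realization of $(a,b)\in\mathbb{H}_t$ is the matrix $[(a,b)]_t=\begin{pmatrix} a & tb\\ \overline{b} & \overline{a}\end{pmatrix}\in M_2(\mathbb{C})$. For a square complex matrix $A$, $\mathrm{spec}(A)=\{\lambda\in\mathbb{C}:\det(A-\lambda I)=0\}$. For a real number $R$, $\sqrt{R}$ denotes a complex square root of $R$ (so $\sqrt{R}=i\sqrt{|R|}$ if $R<0$); $\{p\pm q\}$ denotes $\{p+q,\,p-q\}$. *)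

theory Defs
  imports "HOL-Analysis.Analysis"
begin

(* For every scale t the underlying set of H_t is all of C^2; addition is that of the product type. *)
type_synonym hypercomplex = "complex \<times> complex"

definition hmult :: "real \<Rightarrow> hypercomplex \<Rightarrow> hypercomplex \<Rightarrow> hypercomplex" where
  "hmult t = (\<lambda>(a\<^sub>1, b\<^sub>1) (a\<^sub>2, b\<^sub>2).
     (a\<^sub>1 * a\<^sub>2 + of_real t * b\<^sub>1 * cnj b\<^sub>2, a\<^sub>1 * b\<^sub>2 + b\<^sub>1 * cnj a\<^sub>2))"

definition realization :: "real \<Rightarrow> hypercomplex \<Rightarrow> complex^2^2" where
  "realization t = (\<lambda>(a, b).
     vector [vector [a, of_real t * b],
             vector [cnj b, cnj a]])"

(* The library's mat l is the scalar matrix l I. *)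
definition spec :: "complex^'n^'n \<Rightarrow> complex set" where
  "spec A = {l. det (A - mat l) = 0}"

lemma realization_hmult:
  "realization t (hmult t p q) = realization t p ** realization t q"
  by (cases p; cases q)
     (simp add: realization_def hmult_def vec_eq_iff forall_2 matrix_matrix_mult_def sum_2
                algebra_simps)

lemma det_realization_real: "det (realization t p) \<in> \<real>"
  by (cases p) (simp add: realization_def det_2 complex_is_Real_iff)

(* On real arguments csqrt is the square root convention R < 0 \<longmapsto> i sqrt |R|. *)
lemma csqrt_real:
  "csqrt (of_real R) = (if R < 0 then \<i> * of_real (sqrt \<bar>R\<bar>) else of_real (sqrt R))"
  using csqrt_of_real_nonneg[of "of_real R"] csqrt_of_real_nonpos[of "of_real R"] by auto

end

theory Submission
  imports Defs
begin

text \<open>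
  The characteristic polynomial of a two-by-two matrix is determined by its trace and determinant.
  Completing the square, its roots are \<open>p + s\<close> and \<open>p - s\<close>, where \<open>p\<close> is half the trace and \<open>s\<close>
  is either square root of the discriminant \<open>p\<^sup>2 - det A\<close> (lemma \<open>spec_2_half_trace\<close>). For a
  realization the diagonal entries are conjugate, so half the trace is the real part of \<open>a\<close>; this
  gives the first formula. In real coordinates the discriminant is \<open>-(y\<^sup>2 - t u\<^sup>2 - t v\<^sup>2)\<close>.
  The two formulas may name opposite square roots of it: when \<open>y\<^sup>2 - t u\<^sup>2 - t v\<^sup>2\<close> is negative,
  \<open>\<i> * csqrt (y\<^sup>2 - t u\<^sup>2 - t v\<^sup>2)\<close> is a negative real. Since the lemma accepts any square root,
  both formulas are instances of it and need not be compared with each other.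
\<close>

lemma det_minus_mat_2:
  fixes A :: "complex^2^2"
  shows "det (A - mat l) = l\<^sup>2 - trace A * l + det A"
  by (simp add: det_2 trace_def sum_2 mat_def power2_eq_square algebra_simps)

text \<open>The square root is a parameter rather than \<open>csqrt\<close>, so that no branch has to be
  fixed.\<close>

lemma spec_2_half_trace:
  fixes A :: "complex^2^2"
  assumes "trace A = 2 * p" and "s\<^sup>2 = p\<^sup>2 - det A"
  shows "spec A = {p + s, p - s}"
proof -
  have "l \<in> spec A \<longleftrightarrow> l \<in> {p + s, p - s}" for l
  proof -
    have "det (A - mat l) = (l - p)\<^sup>2 - s\<^sup>2"
      by (simp add: det_minus_mat_2 assms power2_diff algebra_simps)
    then have "l \<in> spec A \<longleftrightarrow> (l - p)\<^sup>2 = s\<^sup>2"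
      by (simp add: spec_def)
    also have "\<dots> \<longleftrightarrow> l - p = s \<or> l - p = - s"
      by (rule power2_eq_iff)
    also have "\<dots> \<longleftrightarrow> l \<in> {p + s, p - s}"
      by (auto simp: algebra_simps)
    finally show ?thesis .
  qed
  then show ?thesis by blast
qed

lemma trace_realization: "trace (realization t (a, b)) = 2 * of_real (Re a)"
  by (simp add: realization_def trace_def sum_2 complex_add_cnj)

lemma det_realization:
  "det (realization t (a, b)) = of_real ((cmod a)\<^sup>2 - t * (cmod b)\<^sup>2)"
  by (simp add: realization_def det_2 complex_norm_square mult.assoc del: of_real_power)

theorem theorem20:
  fixes t :: real and a b :: complex
  shows "spec (realization t (a, b)) =
           {of_real (Re a) + csqrt ((of_real (Re a))\<^sup>2 - det (realization t (a, b))),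
            of_real (Re a) - csqrt ((of_real (Re a))\<^sup>2 - det (realization t (a, b)))}
       \<and> (\<forall>x y u v :: real.
            a = of_real x + of_real y * \<i> \<and> b = of_real u + of_real v * \<i> \<longrightarrow>
            spec (realization t (a, b)) =
              {of_real x + \<i> * csqrt (of_real (y\<^sup>2 - t * u\<^sup>2 - t * v\<^sup>2)),
               of_real x - \<i> * csqrt (of_real (y\<^sup>2 - t * u\<^sup>2 - t * v\<^sup>2))})"
proof (intro conjI allI impI)
  show "spec (realization t (a, b)) =
           {of_real (Re a) + csqrt ((of_real (Re a))\<^sup>2 - det (realization t (a, b))),
            of_real (Re a) - csqrt ((of_real (Re a))\<^sup>2 - det (realization t (a, b)))}"
    by (rule spec_2_half_trace) (simp_all add: trace_realization)
next
  fix x y u v :: real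
  assume ab: "a = of_real x + of_real y * \<i> \<and> b = of_real u + of_real v * \<i>"
  let ?D = "y\<^sup>2 - t * u\<^sup>2 - t * v\<^sup>2"
  have "x\<^sup>2 - ((cmod a)\<^sup>2 - t * (cmod b)\<^sup>2) = - ?D"
    using ab by (simp add: cmod_power2 algebra_simps)
  then have "(of_real x)\<^sup>2 - det (realization t (a, b)) = - of_real ?D"
    unfolding det_realization by (metis of_real_diff of_real_minus of_real_power)
  then have "(\<i> * csqrt (of_real ?D))\<^sup>2 = (of_real x)\<^sup>2 - det (realization t (a, b))"
    by (simp add: power_mult_distrib)
  moreover have "trace (realization t (a, b)) = 2 * of_real x"
    using ab by (simp add: trace_realization)
  ultimately show "spec (realization t (a, b)) =
      {of_real x + \<i> * csqrt (of_real ?D), of_real x - \<i> * csqrt (of_real ?D)}"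
    by (intro spec_2_half_trace)
qed

end
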